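(* Let $X$ be a non-empty Lindelöf locally compact Hausdorff space, let $\mathcal{I}$ be a Riesz ideal of $C(X)$ and $\mathcal{B}$ a strictly point-separating and nowhere-vanishing linear subspace of $\mathcal{I}\cap C_b(X)$ that is also a subalgebra of $C_b(X)$. Then the $\mathcal{I}$-closure of $\mathcal{B}$ is all of $\mathcal{I}$.
   Context: $\mathbb{N}=\{1,2,3,\dots\}$. $C(X)$ is the algebra of real-valued continuous functions on $X$ with pointwise operations and pointwise order; $|f|$ is the pointwise absolute value. $C_b(X)\subseteq C(X)$ is the subalgebra of uniformly bounded functions. A subalgebra is a linear subspace closed under multiplication (not required to contain the unit). A Riesz ideal of $C(X)$ is a linear subspace $\mathcal{I}\subseteq C(X)$ such that $f\in C(X)$, $g\in\mathcal{I}$ and $|f|\le|g|$ imply $f\in\mathcal{I}$. A subset $S\subseteq C(X)$ is strictly point-separating if for all $x,y\in X$ with $x\ne y$ there is $s\in S$ with $s(x)\neq 0$ and $s(y)=0$; it is nowhere-vanishing if for every $x\in X$ there is $s\in S$ with $s(x)\ne 0$. A decreasing sequence $(f_k)_{k\in\mathbb{N}}$ in $\mathcal{I}$ has pointwise infimum $0$ if $\inf_{k} f_k(x)=0$ for all $x\in X$. A sequence $(g_n)_{n\in\mathbb{N}}$ in $\mathcal{I}$ is strictly $\mathcal{I}$-convergent to $\hat g\in\mathcal{I}$ if there exists a decreasing sequence $(f_k)_{k\in\mathbb{N}}$ in $\mathcal{I}$ with pointwise infimum $0$ such that for all $k\in\mathbb{N}$ there is $N\in\mathbb{N}$ with $|\hat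 g-g_n|\le f_k$ for all $n\ge N$. A subset $S\subseteq\mathcal{I}$ is $\mathcal{I}$-closed if whenever a sequence in $S$ is strictly $\mathcal{I}$-convergent to some $\hat s\in\mathcal{I}$, then $\hat s\in S$. The $\mathcal{I}$-closure of a subset $S\subseteq\mathcal{I}$ is the intersection of all $\mathcal{I}$-closed subsets of $\mathcal{I}$ that contain $S$. *)

theory Defs
  imports "HOL-Analysis.Analysis"
begin

text \<open>
  The space is the carrier type \<open>'a\<close> with its type-class topology. Types are inhabited,
  so the space is automatically non-empty.
\<close>

definition cont_funs :: "('a::topological_space \<Rightarrow> real) set"
  where "cont_funs = {f. continuous_on UNIV f}"

definition bdd_cont_funs :: "('a::topological_space \<Rightarrow> real) set"
  where "bdd_cont_funs = {f \<in> cont_funs. bounded (range f)}"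

definition linear_subspace_of :: "('a \<Rightarrow> real) set \<Rightarrow> ('a \<Rightarrow> real) set \<Rightarrow> bool"
  where "linear_subspace_of V W \<longleftrightarrow>
    V \<subseteq> W \<and> (\<lambda>x. 0) \<in> V \<and>
    (\<forall>f\<in>V. \<forall>g\<in>V. (\<lambda>x. f x + g x) \<in> V) \<and>
    (\<forall>c. \<forall>f\<in>V. (\<lambda>x. c * f x) \<in> V)"

text \<open>Subalgebras are not required to contain the constant function 1.\<close>

definition subalgebra_of :: "('a \<Rightarrow> real) set \<Rightarrow> ('a \<Rightarrow> real) set \<Rightarrow> bool"
  where "subalgebra_of A W \<longleftrightarrow>
    linear_subspace_of A W \<and> (\<forall>f\<in>A. \<forall>g\<in>A. (\<lambda>x. f x * g x) \<in> A)"

definition Riesz_ideal :: "('a::topological_space \<Rightarrow> real) set \<Rightarrow> bool"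
  where "Riesz_ideal \<I> \<longleftrightarrow>
    linear_subspace_of \<I> cont_funs \<and>
    (\<forall>f\<in>cont_funs. \<forall>g\<in>\<I>. (\<forall>x. \<bar>f x\<bar> \<le> \<bar>g x\<bar>) \<longrightarrow> f \<in> \<I>)"

definition strictly_point_separating :: "('a \<Rightarrow> real) set \<Rightarrow> bool"
  where "strictly_point_separating S \<longleftrightarrow>
    (\<forall>x y. x \<noteq> y \<longrightarrow> (\<exists>s\<in>S. s x \<noteq> 0 \<and> s y = 0))"

definition nowhere_vanishing :: "('a \<Rightarrow> real) set \<Rightarrow> bool"
  where "nowhere_vanishing S \<longleftrightarrow> (\<forall>x. \<exists>s\<in>S. s x \<noteq> 0)"

text \<open>Boundedness below is explicit because \<open>INF\<close> on the reals is only meaningful under it.\<close>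

definition pointwise_inf_zero :: "(nat \<Rightarrow> 'a \<Rightarrow> real) \<Rightarrow> bool"
  where "pointwise_inf_zero f \<longleftrightarrow>
    (\<forall>x. bdd_below (range (\<lambda>k. f k x)) \<and> (INF k. f k x) = 0)"

text \<open>Sequences are indexed from 0; \<open>decseq\<close> refers to the pointwise order on functions.\<close>

definition strictly_convergent ::
    "('a \<Rightarrow> real) set \<Rightarrow> (nat \<Rightarrow> 'a \<Rightarrow> real) \<Rightarrow> ('a \<Rightarrow> real) \<Rightarrow> bool"
  where "strictly_convergent \<I> g h \<longleftrightarrow>
    range g \<subseteq> \<I> \<and> h \<in> \<I> \<and>
    (\<exists>f. range f \<subseteq> \<I> \<and> decseq f \<and> pointwise_inf_zero f \<and>
      (\<forall>k. \<exists>N. \<forall>n\<ge>N. \<forall>x. \<bar>h x - g n x\<bar> \<le> f k x))"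

definition ideal_closed :: "('a \<Rightarrow> real) set \<Rightarrow> ('a \<Rightarrow> real) set \<Rightarrow> bool"
  where "ideal_closed \<I> S \<longleftrightarrow>
    S \<subseteq> \<I> \<and> (\<forall>g h. range g \<subseteq> S \<and> h \<in> \<I> \<and> strictly_convergent \<I> g h \<longrightarrow> h \<in> S)"

definition ideal_closure :: "('a \<Rightarrow> real) set \<Rightarrow> ('a \<Rightarrow> real) set \<Rightarrow> ('a \<Rightarrow> real) set"
  where "ideal_closure \<I> S = \<Inter>{T. ideal_closed \<I> T \<and> S \<subseteq> T}"

end

theory Submission
  imports Defs
begin

text \<open>
  Write \<open>C\<close> for the \<open>\<I>\<close>-closure of \<open>\<B>\<close>. The proof is an order-theoretic variant of the
  Stone--Weierstrass theorem in which uniform approximation is replaced by monotone pointwise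
  approximation: if functions in \<open>C\<close> converge monotonically and pointwise to some \<open>h \<in> \<I>\<close>, then
  the errors lie in \<open>\<I>\<close> and witness strict convergence, so \<open>h \<in> C\<close>
  (\<open>ideal_closed_monotone_limit\<close>).

  Translations, scalings and the absolute value are pointwise Lipschitz, so \<open>C\<close> is stable under
  them as soon as they map generators into \<open>C\<close> (\<open>ideal_closure_Lipschitz_image\<close>). For the absolute
  value this means \<open>\<bar>b\<bar> \<in> C\<close> for \<open>b \<in> \<B>\<close>, which holds because \<open>\<bar>b\<bar>\<close> is an increasing limit of
  polynomials in \<open>b\<close> without constant term (\<open>abs_generator_in_ideal_closure\<close>). Thus \<open>C\<close> is a
  vector lattice.

  The Lindelof property turns a pointwise infimum of an arbitrary set of majorants into the limit of
  a decreasing sequence of finite minima; hence every \<open>h \<in> \<I>\<close> that is the pointwise infimum of its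
  majorants in \<open>C\<close> lies in \<open>C\<close> (\<open>infimum_of_majorants\<close>). This is used twice. A nonnegative
  \<open>f \<in> \<I>\<close> with compact support is such an infimum because \<open>\<B>\<close> separates points strictly and
  vanishes nowhere (\<open>compactly_supported_majorant\<close>). A general nonnegative \<open>f \<in> \<I>\<close> is, by local compactness, the
  pointwise supremum of its products with compactly supported bump functions, so \<open>-f\<close> is an infimum
  of majorants in \<open>C\<close> (\<open>nonneg_mem\<close>). Every element of \<open>\<I>\<close> is a difference of two nonnegative ones.
\<close>

section \<open>Riesz ideals and monotone approximation\<close>

lemma ideal_continuous: "continuous_on UNIV f" if "Riesz_ideal \<I>" "f \<in> \<I>"
  using that by (auto simp: Riesz_ideal_def linear_subspace_of_def cont_funs_def)

lemma ideal_add: "(\<lambda>x. f x + g x) \<in> \<I>" if "Riesz_ideal \<I>" "f \<in> \<I>" "g \<in> \<I>"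
  using that by (auto simp: Riesz_ideal_def linear_subspace_of_def)

lemma ideal_scale: "(\<lambda>x. c * f x) \<in> \<I>" if "Riesz_ideal \<I>" "f \<in> \<I>"
  using that by (auto simp: Riesz_ideal_def linear_subspace_of_def)

lemma ideal_dominated: "f \<in> \<I>"
  if "Riesz_ideal \<I>" "continuous_on UNIV f" "g \<in> \<I>" "\<And>x. \<bar>f x\<bar> \<le> \<bar>g x\<bar>"
  using that by (auto simp: Riesz_ideal_def cont_funs_def)

lemma ideal_abs: "(\<lambda>x. \<bar>f x\<bar>) \<in> \<I>" if "Riesz_ideal \<I>" "f \<in> \<I>"
  by (rule ideal_dominated[OF that(1) _ that(2)])
    (auto intro!: continuous_intros ideal_continuous[OF that])

lemma ideal_diff: "(\<lambda>x. f x - g x) \<in> \<I>" if "Riesz_ideal \<I>" "f \<in> \<I>" "g \<in> \<I>"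
  using ideal_add[OF that(1,2) ideal_scale[OF that(1,3), of "-1"]] by simp

lemma decseq_pointwise: "decseq f \<longleftrightarrow> (\<forall>x. decseq (\<lambda>k. f k x))"
  for f :: "nat \<Rightarrow> 'a \<Rightarrow> real"
  unfolding monotone_def le_fun_def by blast

lemma pointwise_inf_zeroI:
  assumes "decseq f" and lim: "\<And>x. (\<lambda>k. f k x) \<longlonglongrightarrow> 0"
  shows "pointwise_inf_zero f"
  unfolding pointwise_inf_zero_def
proof (intro allI conjI)
  fix x
  have dec: "decseq (\<lambda>k. f k x)"
    using assms(1) by (simp add: decseq_pointwise)
  have "0 \<le> f k x" for k
    using decseq_ge[OF dec lim] .
  then show bdd: "bdd_below (range (\<lambda>k. f k x))"
    by (intro bdd_belowI[of _ 0]) auto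
  show "(INF k. f k x) = 0"
    using LIMSEQ_unique[OF LIMSEQ_decseq_INF[OF bdd dec] lim] .
qed

text \<open>
  Monotone pointwise approximation inside \<open>\<I>\<close> is automatically strict: the errors
  \<open>\<bar>h - g\<^sub>n\<bar>\<close> themselves lie in \<open>\<I>\<close> and serve as the dominating sequence.
\<close>
lemma ideal_closed_monotone_limit:
  assumes I: "Riesz_ideal \<I>" and T: "ideal_closed \<I> T"
    and g: "\<And>n. g n \<in> T" and h: "h \<in> \<I>"
    and dec: "decseq (\<lambda>n x. \<bar>h x - g n x\<bar>)"
    and lim: "\<And>x. (\<lambda>n. g n x) \<longlonglongrightarrow> h x"
  shows "h \<in> T"
proof -
  have TI: "T \<subseteq> \<I>"
    using T by (simp add: ideal_closed_def)
  have "(\<lambda>n. \<bar>h x - g n x\<bar>) \<longlonglongrightarrow> 0" for x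
    using tendsto_rabs[OF tendsto_diff[OF tendsto_const[of "h x"] lim[of x]]] by simp
  then have inf: "pointwise_inf_zero (\<lambda>n x. \<bar>h x - g n x\<bar>)"
    using pointwise_inf_zeroI[OF dec] by simp
  have "strictly_convergent \<I> g h"
    unfolding strictly_convergent_def
  proof (intro conjI exI[of _ "\<lambda>n x. \<bar>h x - g n x\<bar>"] allI)
    show "range (\<lambda>n x. \<bar>h x - g n x\<bar>) \<subseteq> \<I>"
      using ideal_abs[OF I ideal_diff[OF I h]] g TI by blast
    show "\<exists>N. \<forall>n\<ge>N. \<forall>x. \<bar>h x - g n x\<bar> \<le> \<bar>h x - g k x\<bar>" for k
      using dec decseqD[of _ k] unfolding decseq_pointwise by (intro exI[of _ k]) blast
  qed (use h g TI dec inf in auto)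
  then show ?thesis
    using T g h unfolding ideal_closed_def by blast
qed

section \<open>Algebraic structure of the ideal closure\<close>

lemma ideal_closure_subset_ideal: "ideal_closure \<I> S \<subseteq> \<I>" if "S \<subseteq> \<I>"
proof -
  have "ideal_closed \<I> \<I>"
    by (auto simp: ideal_closed_def)
  then show ?thesis
    using that by (auto simp: ideal_closure_def)
qed

lemma subset_ideal_closure: "S \<subseteq> ideal_closure \<I> S"
  by (auto simp: ideal_closure_def)

lemma ideal_closure_minimal: "ideal_closure \<I> S \<subseteq> T" if "ideal_closed \<I> T" "S \<subseteq> T"
  using that by (auto simp: ideal_closure_def)

lemma ideal_closed_ideal_closure: "ideal_closed \<I> (ideal_closure \<I> S)" if "S \<subseteq> \<I>"
  unfolding ideal_closed_def
proof (intro conjI allI impI ideal_closure_subset_ideal[OF that])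
  fix g h
  assume gh: "range g \<subseteq> ideal_closure \<I> S \<and> h \<in> \<I> \<and> strictly_convergent \<I> g h"
  show "h \<in> ideal_closure \<I> S"
    unfolding ideal_closure_def
  proof (intro InterI)
    fix T
    assume T: "T \<in> {T. ideal_closed \<I> T \<and> S \<subseteq> T}"
    then have "range g \<subseteq> T"
      using gh ideal_closure_minimal[of \<I> T S] by blast
    then show "h \<in> T"
      using T gh by (auto simp: ideal_closed_def)
  qed
qed

text \<open>
  A pointwise Lipschitz operator multiplies the dominating sequence by a constant, so it preserves
  strict convergence, and preimages of ideal-closed sets under it are ideal-closed. Hence it
  suffices to check on generators that it maps into the closure. Translations, scalings and the
  absolute value are all of this form.
\<close>
lemma ideal_closure_Lipschitz_image:
  assumes I: "Riesz_ideal \<I>" and S: "S \<subseteq> \<I>"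
    and \<phi>: "\<And>f. f \<in> \<I> \<Longrightarrow> \<phi> f \<in> \<I>"
    and "0 \<le> M"
    and Lip: "\<And>f g x. \<bar>\<phi> f x - \<phi> g x\<bar> \<le> M * \<bar>f x - g x\<bar>"
    and gen: "\<And>f. f \<in> S \<Longrightarrow> \<phi> f \<in> ideal_closure \<I> S"
    and f: "f \<in> ideal_closure \<I> S"
  shows "\<phi> f \<in> ideal_closure \<I> S"
proof -
  let ?C = "ideal_closure \<I> S"
  let ?T = "{f \<in> ?C. \<phi> f \<in> ?C}"
  note C = ideal_closed_ideal_closure[OF S] ideal_closure_subset_ideal[OF S]
  have "ideal_closed \<I> ?T"
    unfolding ideal_closed_def
  proof (intro conjI allI impI)
    fix g h
    assume gh: "range g \<subseteq> ?T \<and> h \<in> \<I> \<and> strictly_convergent \<I> g h"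
    then obtain d where d: "range d \<subseteq> \<I>" "decseq d" "pointwise_inf_zero d"
      and conv: "\<And>k. \<exists>N. \<forall>n\<ge>N. \<forall>x. \<bar>h x - g n x\<bar> \<le> d k x"
      unfolding strictly_convergent_def by blast
    have "strictly_convergent \<I> (\<lambda>n. \<phi> (g n)) (\<phi> h)"
      unfolding strictly_convergent_def
    proof (intro conjI exI[of _ "\<lambda>k x. M * d k x"] allI)
      show "range (\<lambda>n. \<phi> (g n)) \<subseteq> \<I>"
        using gh C(2) by auto
      show "\<phi> h \<in> \<I>"
        using gh \<phi> by blast
      show "range (\<lambda>k x. M * d k x) \<subseteq> \<I>"
        using d(1) ideal_scale[OF I] by blast
      show dec: "decseq (\<lambda>k x. M * d k x)"
        using d(2) \<open>0 \<le> M\<close> unfolding decseq_pointwise by (simp add: decseq_def mult_left_mono)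
      show "pointwise_inf_zero (\<lambda>k x. M * d k x)"
      proof (rule pointwise_inf_zeroI[OF dec])
        fix x
        have "bdd_below (range (\<lambda>k. d k x))" "(INF k. d k x) = 0"
          using d(3) by (auto simp: pointwise_inf_zero_def)
        moreover have "decseq (\<lambda>k. d k x)"
          using d(2) by (simp add: decseq_pointwise)
        ultimately have "(\<lambda>k. d k x) \<longlonglongrightarrow> 0"
          using LIMSEQ_decseq_INF by metis
        then show "(\<lambda>k. M * d k x) \<longlonglongrightarrow> 0"
          by (rule tendsto_mult_right_zero)
      qed
      show "\<exists>N. \<forall>n\<ge>N. \<forall>x. \<bar>\<phi> h x - \<phi> (g n) x\<bar> \<le> M * d k x" for k
        using conv[of k] Lip \<open>0 \<le> M\<close> by (meson mult_left_mono order_trans)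
    qed
    moreover have "range (\<lambda>n. \<phi> (g n)) \<subseteq> ?C" "\<phi> h \<in> \<I>" "range g \<subseteq> ?C"
      using gh \<phi> by auto
    ultimately show "h \<in> ?T"
      using C(1) gh unfolding ideal_closed_def by blast
  qed (use C(2) in auto)
  moreover have "S \<subseteq> ?T"
    using gen subset_ideal_closure by blast
  ultimately show ?thesis
    using ideal_closure_minimal f by blast
qed

lemma ideal_closure_add:
  assumes I: "Riesz_ideal \<I>" and S: "S \<subseteq> \<I>"
    and add: "\<And>f g. f \<in> S \<Longrightarrow> g \<in> S \<Longrightarrow> (\<lambda>x. f x + g x) \<in> S"
    and f: "f \<in> ideal_closure \<I> S" and g: "g \<in> ideal_closure \<I> S"
  shows "(\<lambda>x. f x + g x) \<in> ideal_closure \<I> S"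
proof -
  note CI = ideal_closure_subset_ideal[OF S]
  have generator: "(\<lambda>x. b x + f x) \<in> ideal_closure \<I> S"
    if "b \<in> S" "f \<in> ideal_closure \<I> S" for b f
  proof (rule ideal_closure_Lipschitz_image[OF I S, where M = 1 and \<phi> = "\<lambda>f x. b x + f x"])
    show "(\<lambda>x. b x + u x) \<in> \<I>" if "u \<in> \<I>" for u
      using that \<open>b \<in> S\<close> S ideal_add[OF I] by blast
    show "(\<lambda>x. b x + u x) \<in> ideal_closure \<I> S" if "u \<in> S" for u
      using that \<open>b \<in> S\<close> add subset_ideal_closure by blast
  qed (use that in auto)
  show ?thesis
  proof (rule ideal_closure_Lipschitz_image[OF I S, where M = 1 and \<phi> = "\<lambda>g x. f x + g x"])
    show "(\<lambda>x. f x + u x) \<in> \<I>" if "u \<in> \<I>" for u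
      using that f CI ideal_add[OF I] by blast
    show "(\<lambda>x. f x + u x) \<in> ideal_closure \<I> S" if "u \<in> S" for u
      using generator[OF that f] by (simp add: add.commute)
  qed (use g in auto)
qed

lemma ideal_closure_scale:
  assumes I: "Riesz_ideal \<I>" and S: "S \<subseteq> \<I>"
    and scale: "\<And>f. f \<in> S \<Longrightarrow> (\<lambda>x. c * f x) \<in> S"
    and f: "f \<in> ideal_closure \<I> S"
  shows "(\<lambda>x. c * f x) \<in> ideal_closure \<I> S"
proof (rule ideal_closure_Lipschitz_image[OF I S, where M = "\<bar>c\<bar>" and \<phi> = "\<lambda>f x. c * f x"])
  show "\<bar>c * u x - c * v x\<bar> \<le> \<bar>c\<bar> * \<bar>u x - v x\<bar>" for u v :: "'a \<Rightarrow> real" and x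
    by (simp add: abs_mult flip: right_diff_distrib)
  show "(\<lambda>x. c * u x) \<in> ideal_closure \<I> S" if "u \<in> S" for u
    using that scale subset_ideal_closure by blast
qed (use f ideal_scale[OF I] in auto)

section \<open>Absolute values of elements of the subalgebra\<close>

text \<open>
  Polynomials in \<open>t\<close> without constant term that increase to \<open>\<bar>t\<bar>\<close> on \<open>[-1, 1]\<close>. The missing
  constant term matters because a subalgebra need not contain the unit, and monotonicity is what
  makes the approximation strict.
\<close>
primrec abs_poly :: "nat \<Rightarrow> real \<Rightarrow> real" where
  "abs_poly 0 t = 0"
| "abs_poly (Suc n) t = abs_poly n t + (1/2) * (t * t + (-1) * (abs_poly n t * abs_poly n t))"

text \<open>
  For \<open>0 \<le> p\<^sub>n \<le> \<bar>t\<bar> \<le> 1\<close> the error factor below lies in \<open>[0, 1 - \<bar>t\<bar> / 2]\<close>. This gives at once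
  that the bounds persist, that the error decreases, and that it vanishes geometrically.
\<close>
lemma abs_poly_error_Suc:
  "\<bar>t\<bar> - abs_poly (Suc n) t = (\<bar>t\<bar> - abs_poly n t) * (1 - (\<bar>t\<bar> + abs_poly n t) / 2)"
proof -
  have "t * t = \<bar>t\<bar> * \<bar>t\<bar>" by simp
  then show ?thesis
    unfolding abs_poly.simps by (simp add: algebra_simps add_divide_distrib diff_divide_distrib)
qed

lemma abs_poly_bounds:
  assumes "\<bar>t\<bar> \<le> 1"
  shows "0 \<le> abs_poly n t \<and> abs_poly n t \<le> \<bar>t\<bar>"
proof (induction n)
  case (Suc n)
  have "abs_poly n t * abs_poly n t \<le> \<bar>t\<bar> * \<bar>t\<bar>"
    using Suc by (intro mult_mono) auto
  moreover have "0 \<le> (\<bar>t\<bar> - abs_poly n t) * (1 - (\<bar>t\<bar> + abs_poly n t) / 2)"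
    using Suc assms by (intro mult_nonneg_nonneg) auto
  ultimately show ?case
    using Suc abs_poly_error_Suc[of t n] by simp
qed simp

lemma abs_poly_error_decreasing:
  assumes "\<bar>t\<bar> \<le> 1"
  shows "decseq (\<lambda>n. \<bar>\<bar>t\<bar> - abs_poly n t\<bar>)"
proof (rule decseq_SucI)
  fix n
  have "(\<bar>t\<bar> - abs_poly n t) * (1 - (\<bar>t\<bar> + abs_poly n t) / 2) \<le> \<bar>t\<bar> - abs_poly n t"
    using abs_poly_bounds[OF assms, of n] by (intro mult_left_le) auto
  then show "\<bar>\<bar>t\<bar> - abs_poly (Suc n) t\<bar> \<le> \<bar>\<bar>t\<bar> - abs_poly n t\<bar>"
    using abs_poly_error_Suc[of t n] abs_poly_bounds[OF assms, of n]
      abs_poly_bounds[OF assms, of "Suc n"] by linarith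
qed

lemma abs_poly_error_geometric:
  assumes "\<bar>t\<bar> \<le> 1"
  shows "\<bar>t\<bar> - abs_poly n t \<le> \<bar>t\<bar> * (1 - \<bar>t\<bar> / 2) ^ n"
proof (induction n)
  case (Suc n)
  have "(\<bar>t\<bar> - abs_poly n t) * (1 - (\<bar>t\<bar> + abs_poly n t) / 2)
      \<le> (\<bar>t\<bar> * (1 - \<bar>t\<bar> / 2) ^ n) * (1 - \<bar>t\<bar> / 2)"
    using Suc abs_poly_bounds[OF assms, of n] assms by (intro mult_mono) auto
  then show ?case
    unfolding abs_poly_error_Suc by (simp add: ac_simps)
qed simp

lemma abs_poly_tendsto:
  assumes "\<bar>t\<bar> \<le> 1"
  shows "(\<lambda>n. abs_poly n t) \<longlonglongrightarrow> \<bar>t\<bar>"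
proof (cases "t = 0")
  case True
  have "abs_poly n 0 = 0" for n
    using abs_poly_bounds[of 0 n] by simp
  then show ?thesis
    using True by simp
next
  case False
  have "(\<lambda>n. (1 - \<bar>t\<bar> / 2) ^ n) \<longlonglongrightarrow> 0"
    using False assms by (intro LIMSEQ_realpow_zero) auto
  from tendsto_mult_right_zero[OF this, of "\<bar>t\<bar>"]
  have "(\<lambda>n. \<bar>t\<bar> - abs_poly n t) \<longlonglongrightarrow> 0"
    by (rule tendsto_sandwich[rotated 3])
      (use abs_poly_bounds[OF assms] abs_poly_error_geometric[OF assms] in auto)
  from tendsto_diff[OF tendsto_const[of "\<bar>t\<bar>"] this] show ?thesis
    by simp
qed

lemma subalgebra_abs_poly:
  assumes "subalgebra_of B W" "f \<in> B"
  shows "(\<lambda>x. abs_poly n (f x)) \<in> B"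
proof (induction n)
  case 0
  show ?case
    using assms(1) by (simp add: subalgebra_of_def linear_subspace_of_def)
next
  case (Suc n)
  have add: "(\<lambda>x. u x + v x) \<in> B" if "u \<in> B" "v \<in> B" for u v
    using that assms(1) by (simp add: subalgebra_of_def linear_subspace_of_def)
  have scale: "(\<lambda>x. c * u x) \<in> B" if "u \<in> B" for c u
    using that assms(1) by (simp add: subalgebra_of_def linear_subspace_of_def)
  have mult: "(\<lambda>x. u x * v x) \<in> B" if "u \<in> B" "v \<in> B" for u v
    using that assms(1) by (simp add: subalgebra_of_def)
  show ?case
    unfolding abs_poly.simps
    by (rule add[OF Suc scale[OF add[OF mult[OF assms(2) assms(2)] scale[OF mult[OF Suc Suc]]]]])
qed

text \<open>
  Since \<open>b\<close> is bounded, it can be rescaled into \<open>[-1, 1]\<close>, where the polynomials increase to the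
  absolute value.
\<close>
lemma abs_generator_in_ideal_closure:
  assumes I: "Riesz_ideal \<I>" and B: "B \<subseteq> \<I>" and alg: "subalgebra_of B bdd_cont_funs"
    and b: "b \<in> B"
  shows "(\<lambda>x. \<bar>b x\<bar>) \<in> ideal_closure \<I> B"
proof -
  have scale: "(\<lambda>x. c * u x) \<in> B" if "u \<in> B" for c u
    using that alg by (simp add: subalgebra_of_def linear_subspace_of_def)
  have "bounded (range b)"
    using b alg by (auto simp: subalgebra_of_def linear_subspace_of_def bdd_cont_funs_def)
  then obtain M where M: "0 < M" "\<And>x. \<bar>b x\<bar> \<le> M"
    by (auto simp: bounded_pos)
  define u where "u = (\<lambda>x. inverse M * b x)"
  have uB: "u \<in> B"
    unfolding u_def by (rule scale[OF b])
  have u1: "\<bar>u x\<bar> \<le> 1" for x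
    using M by (simp add: u_def abs_mult field_simps)
  have "(\<lambda>x. \<bar>u x\<bar>) \<in> ideal_closure \<I> B"
  proof (rule ideal_closed_monotone_limit[OF I ideal_closed_ideal_closure[OF B]])
    show "(\<lambda>x. abs_poly n (u x)) \<in> ideal_closure \<I> B" for n
      using subalgebra_abs_poly[OF alg uB] subset_ideal_closure by blast
    show "(\<lambda>x. \<bar>u x\<bar>) \<in> \<I>"
      using ideal_abs[OF I] uB B by blast
    show "decseq (\<lambda>n x. \<bar>\<bar>u x\<bar> - abs_poly n (u x)\<bar>)"
      using abs_poly_error_decreasing[OF u1] by (simp add: decseq_pointwise)
    show "(\<lambda>n. abs_poly n (u x)) \<longlonglongrightarrow> \<bar>u x\<bar>" for x
      by (rule abs_poly_tendsto[OF u1])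
  qed
  from ideal_closure_scale[OF I B scale this, of M] show ?thesis
    using M(1) by (simp add: u_def abs_mult flip: mult.assoc)
qed

section \<open>Ideal-closed vector lattices\<close>

locale ideal_closed_lattice =
  fixes \<I> C :: "('a::t2_space \<Rightarrow> real) set"
  assumes ideal: "Riesz_ideal \<I>"
    and closed: "ideal_closed \<I> C"
    and add: "f \<in> C \<Longrightarrow> g \<in> C \<Longrightarrow> (\<lambda>x. f x + g x) \<in> C"
    and scale: "f \<in> C \<Longrightarrow> (\<lambda>x. c * f x) \<in> C"
    and abs: "f \<in> C \<Longrightarrow> (\<lambda>x. \<bar>f x\<bar>) \<in> C"
begin

lemma subset_ideal: "C \<subseteq> \<I>"
  using closed by (simp add: ideal_closed_def)

lemma continuous: "f \<in> C \<Longrightarrow> continuous_on UNIV f"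
  using ideal_continuous[OF ideal] subset_ideal by blast

lemma diff: "(\<lambda>x. f x - g x) \<in> C" if "f \<in> C" "g \<in> C"
  using add[OF that(1) scale[OF that(2), of "-1"]] by simp

lemma max: "(\<lambda>x. max (f x) (g x)) \<in> C" if "f \<in> C" "g \<in> C"
proof -
  have "(\<lambda>x. max (f x) (g x)) = (\<lambda>x. (1/2) * ((f x + g x) + \<bar>f x - g x\<bar>))"
    by (auto simp: max_def)
  then show ?thesis
    using scale[OF add[OF add[OF that] abs[OF diff[OF that]]], of "1/2"] by simp
qed

lemma min: "(\<lambda>x. min (f x) (g x)) \<in> C" if "f \<in> C" "g \<in> C"
proof -
  have "(\<lambda>x. min (f x) (g x)) = (\<lambda>x. (f x + g x) - max (f x) (g x))"
    by (auto simp: max_def min_def)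
  then show ?thesis
    using diff[OF add[OF that] max[OF that]] by simp
qed

text \<open>
  For each precision the open sets on which a majorant from \<open>C\<close> comes close to \<open>h\<close> cover the
  space. By the Lindelof property countably many majorants suffice for all precisions together, and
  the minima of the first \<open>n\<close> of them decrease to \<open>h\<close>.
\<close>
lemma infimum_of_majorants:
  assumes Lindelof: "Lindelof_space (euclidean :: 'a topology)"
    and h: "h \<in> \<I>"
    and approx: "\<And>y e. 0 < e \<Longrightarrow> \<exists>u\<in>C. (\<forall>x. h x \<le> u x) \<and> u y < h y + e"
  shows "h \<in> C"
proof -
  define D where "D = {u \<in> C. \<forall>x. h x \<le> u x}"
  define W where "W = (\<lambda>n u. {x. u x < h x + inverse (real (Suc n))})"
  have "\<exists>E. countable E \<and> E \<subseteq> D \<and> (\<Union>u\<in>E. W n u) = UNIV" for n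
  proof -
    have "open (W n u)" if "u \<in> D" for u
      using that unfolding W_def D_def
      by (intro open_Collect_less continuous_intros continuous ideal_continuous[OF ideal h]) auto
    moreover have "(\<Union>u\<in>D. W n u) = UNIV"
      using approx[of "inverse (real (Suc n))"] by (fastforce simp: W_def D_def)
    ultimately have "\<exists>\<V>. countable \<V> \<and> \<V> \<subseteq> W n ` D \<and> \<Union>\<V> = UNIV"
      using Lindelof_spaceD[OF Lindelof, of "W n ` D"] by auto
    then obtain \<V> where \<V>: "countable \<V>" "\<V> \<subseteq> W n ` D" "\<Union>\<V> = UNIV"
      by (elim exE conjE)
    then obtain E where "countable E" "E \<subseteq> D" "\<V> = W n ` E"
      using countable_subset_image[THEN iffD1, OF conjI, OF \<V>(1,2)] by (elim exE conjE)
    then show ?thesis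
      using \<V>(3) by auto
  qed
  then obtain E where E: "\<And>n. countable (E n)" "\<And>n. E n \<subseteq> D" "\<And>n. (\<Union>u\<in>E n. W n u) = UNIV"
    by metis
  define U where "U = (\<Union>n. E n)"
  have "countable U" "U \<noteq> {}"
    using E unfolding U_def by (auto simp: set_eq_iff) blast
  define u where "u = from_nat_into U"
  have range_u: "range u = U"
    using range_from_nat_into[OF \<open>U \<noteq> {}\<close> \<open>countable U\<close>] by (simp add: u_def)
  have uD: "u n \<in> D" for n
    using range_u E(2) by (auto simp: U_def)
  define v where "v = rec_nat (u 0) (\<lambda>n w x. min (w x) (u (Suc n) x))"
  have v_simps: "v 0 = u 0" "\<And>n. v (Suc n) = (\<lambda>x. min (v n x) (u (Suc n) x))"
    by (simp_all add: v_def)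
  have vD: "v n \<in> D" for n
    by (induction n) (use uD in \<open>auto simp: v_simps D_def intro!: min\<close>)
  have v_le_u: "v n x \<le> u n x" for n x
    by (cases n) (auto simp: v_simps)
  have decv: "decseq v"
    by (rule decseq_SucI) (auto simp: v_simps le_fun_def)
  have h_le_v: "h x \<le> v n x" for n x
    using vD by (simp add: D_def)
  show "h \<in> C"
  proof (rule ideal_closed_monotone_limit[OF ideal closed])
    show "v n \<in> C" for n
      using vD by (simp add: D_def)
    show "decseq (\<lambda>n x. \<bar>h x - v n x\<bar>)"
      using decv h_le_v unfolding decseq_pointwise
      by (simp add: abs_minus_commute[of "h _"] decseq_def)
    show "(\<lambda>n. v n x) \<longlonglongrightarrow> h x" for x
    proof (rule LIMSEQ_I)
      fix r :: real
      assume "0 < r"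
      then obtain n where n: "inverse (real (Suc n)) < r"
        using reals_Archimedean by blast
      obtain w where "w \<in> E n" "x \<in> W n w"
        using E(3)[of n] by blast
      moreover from \<open>w \<in> E n\<close> have "w \<in> range u"
        unfolding range_u U_def by blast
      ultimately obtain m where "u m x < h x + inverse (real (Suc n))"
        by (auto simp: W_def)
      then have "v m x < h x + r"
        using v_le_u[of m x] n by linarith
      then have "norm (v k x - h x) < r" if "k \<ge> m" for k
        using that decv h_le_v[of x k] decseqD[of "\<lambda>n. v n x" m k]
        by (auto simp: decseq_pointwise)
      then show "\<exists>N. \<forall>k\<ge>N. norm (v k x - h x) < r"
        by blast
    qed
  qed (rule h)
qed

text \<open>
  This is one half of the usual lattice argument for the Stone--Weierstrass theorem. A
  nonnegative function in \<open>C\<close> can be made larger than \<open>f\<close> at a given point while staying below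
  \<open>f y + e\<close> at \<open>y\<close>: for points other than \<open>y\<close> this is strict separation, for \<open>y\<close> itself
  nonvanishing. By continuity and compactness finitely many such functions dominate \<open>f\<close> on \<open>K\<close>;
  off \<open>K\<close>, where \<open>f\<close> is zero, their maximum dominates \<open>f\<close> because it is nonnegative.
\<close>
lemma compactly_supported_majorant:
  assumes sep: "strictly_point_separating C" and nv: "nowhere_vanishing C"
    and cont: "continuous_on UNIV f" and nonneg: "\<And>x. 0 \<le> f x"
    and K: "compact K" and supp: "\<And>x. x \<notin> K \<Longrightarrow> f x = 0"
    and "0 < e"
  shows "\<exists>u\<in>C. (\<forall>x. f x \<le> u x) \<and> u y < f y + e"
proof -
  have value_at: "\<exists>w\<in>C. (\<forall>z. 0 \<le> w z) \<and> w x = c \<and> (x \<noteq> y \<longrightarrow> w y = 0)"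
    if "0 \<le> c" for x c
  proof -
    obtain s where s: "s \<in> C" "s x \<noteq> 0" "x \<noteq> y \<longrightarrow> s y = 0"
      using sep nv unfolding strictly_point_separating_def nowhere_vanishing_def by metis
    show ?thesis
    proof (intro bexI conjI allI)
      show "(\<lambda>z. (c / \<bar>s x\<bar>) * \<bar>s z\<bar>) \<in> C"
        by (rule scale[OF abs[OF s(1)]])
    qed (use s that in auto)
  qed
  have "\<exists>w\<in>C. (\<forall>z. 0 \<le> w z) \<and> f x < w x \<and> w y < f y + e" for x
  proof -
    obtain w where "w \<in> C" "\<forall>z. 0 \<le> w z" "w x = f x + e/2" "x \<noteq> y \<longrightarrow> w y = 0"
      using value_at[of "f x + e/2" x] nonneg[of x] \<open>0 < e\<close> by auto
    then show ?thesis
      using nonneg[of y] \<open>0 < e\<close> by (intro bexI[of _ w]) (cases "x = y"; simp)+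
  qed
  then obtain w where w: "\<And>x. w x \<in> C" "\<And>x z. 0 \<le> w x z" "\<And>x. f x < w x x"
      "\<And>x. w x y < f y + e"
    by metis
  have "open {z. f z < w x z}" for x
    by (intro open_Collect_less cont continuous w(1))
  moreover have "K \<subseteq> (\<Union>x\<in>K. {z. f z < w x z})"
    using w(3) by blast
  ultimately obtain F where F: "finite F" "K \<subseteq> (\<Union>x\<in>F. {z. f z < w x z})"
    using compactE_image[OF K, of K "\<lambda>x. {z. f z < w x z}"] by metis
  \<comment> \<open>\<open>w y\<close> serves as the starting value, so that an empty \<open>F\<close> needs no separate treatment.\<close>
  have "\<exists>v\<in>C. (\<forall>z. 0 \<le> v z) \<and> v y < f y + e \<and> (\<forall>x\<in>F. \<forall>z. w x z \<le> v z)"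
    using F(1)
  proof induction
    case empty
    then show ?case
      using w(1,2,4)[of y] by auto
  next
    case (insert a F)
    then obtain v where "v \<in> C" "\<forall>z. 0 \<le> v z" "v y < f y + e" "\<forall>x\<in>F. \<forall>z. w x z \<le> v z"
      by blast
    then show ?case
      using w(4)[of a]
      by (intro bexI[OF _ max[OF w(1)[of a] \<open>v \<in> C\<close>]]) (auto simp: le_max_iff_disj)
  qed
  then obtain v where v: "v \<in> C" "\<And>z. 0 \<le> v z" "v y < f y + e" "\<And>x z. x \<in> F \<Longrightarrow> w x z \<le> v z"
    by blast
  have "f z \<le> v z" for z
  proof (cases "z \<in> K")
    case True
    then obtain x where "x \<in> F" "f z < w x z"
      using F(2) by blast
    then show ?thesis
      using v(4)[of x z] by linarith
  qed (use supp v(2) in simp)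
  then show ?thesis
    using v by blast
qed

end

section \<open>Density\<close>

lemma locally_compact_bump:
  fixes y :: "'a::t2_space"
  assumes "locally_compact_space (euclidean :: 'a topology)"
  obtains p K where "continuous_on UNIV p" "\<And>x. 0 \<le> p x" "\<And>x. p x \<le> 1" "p y = (1::real)"
    "compact K" "\<And>x. x \<notin> K \<Longrightarrow> p x = 0"
proof -
  have haus: "Hausdorff_space (euclidean :: 'a topology)"
    unfolding Hausdorff_space_def by (simp add: disjnt_def) (meson hausdorff)
  obtain U K where UK: "open U" "compact K" "y \<in> U" "U \<subseteq> K"
    using assms unfolding locally_compact_space_def by (simp flip: open_openin) metis
  have "completely_regular_space (euclidean :: 'a topology)"
    using assms haus by (intro locally_compact_regular_imp_completely_regular_space) auto
  then obtain q where q: "continuous_map euclidean (top_of_set {0..1}) q" "q y = (0::real)"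
      "q ` (- U) \<subseteq> {1}"
    using UK unfolding completely_regular_space_def 
    by (metis Compl_iff DiffI UNIV_I closed_Compl closed_closedin topspace_euclidean)
  have "continuous_on UNIV q" "\<And>x. q x \<in> {0..1}"
    using q(1) by (auto simp: continuous_map_in_subtopology)
  then show ?thesis
    using q(2,3) UK by (intro that[of "\<lambda>x. 1 - q x" K]) (auto intro!: continuous_intros)
qed

context ideal_closed_lattice
begin

text \<open>
  A nonnegative \<open>f\<close> with compact support is an infimum of majorants from \<open>C\<close>. In general \<open>f\<close> is
  the supremum of its products with bump functions, which lie in \<open>C\<close> because they are compactly
  supported; dually, \<open>-f\<close> is an infimum of majorants from \<open>C\<close>.
\<close>
lemma nonneg_mem:
  assumes Lindelof: "Lindelof_space (euclidean :: 'a topology)"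
    and lc: "locally_compact_space (euclidean :: 'a topology)"
    and sep: "strictly_point_separating C" and nv: "nowhere_vanishing C"
    and f: "f \<in> \<I>" and nonneg: "\<And>x. 0 \<le> f x"
  shows "f \<in> C"
proof -
  have "(\<lambda>x. - f x) \<in> C"
  proof (rule infimum_of_majorants[OF Lindelof])
    show "(\<lambda>x. - f x) \<in> \<I>"
      using ideal_scale[OF ideal f, of "-1"] by simp
    fix y :: 'a and e :: real
    assume "0 < e"
    obtain p K where p: "continuous_on UNIV p" "\<And>x. 0 \<le> p x" "\<And>x. p x \<le> 1" "p y = (1::real)"
      and K: "compact K" "\<And>x. x \<notin> K \<Longrightarrow> p x = 0"
      using locally_compact_bump[OF lc, of y] by metis
    let ?g = "\<lambda>x. p x * f x"
    have cont: "continuous_on UNIV ?g"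
      by (intro continuous_intros p(1) ideal_continuous[OF ideal f])
    have le: "?g x \<le> f x" for x
      using mult_right_mono[OF p(3) nonneg] by simp
    have "?g \<in> C"
    proof (rule infimum_of_majorants[OF Lindelof])
      show "?g \<in> \<I>"
        by (rule ideal_dominated[OF ideal cont f]) (use le p(2) nonneg in simp)
      show "\<exists>u\<in>C. (\<forall>x. ?g x \<le> u x) \<and> u z < ?g z + d" if "0 < d" for z d
        by (rule compactly_supported_majorant[OF sep nv cont _ K(1)])
          (use p(2) nonneg K(2) that in auto)
    qed
    then have "(\<lambda>x. - ?g x) \<in> C"
      using scale[of ?g "-1"] by simp
    then show "\<exists>u\<in>C. (\<forall>x. - f x \<le> u x) \<and> u y < - f y + e"
      using le p(4) \<open>0 < e\<close> by (intro bexI[of _ "\<lambda>x. - ?g x"]) auto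
  qed
  from scale[OF this, of "-1"] show ?thesis
    by simp
qed

lemma eq_ideal:
  assumes "Lindelof_space (euclidean :: 'a topology)"
    and "locally_compact_space (euclidean :: 'a topology)"
    and "strictly_point_separating C" and "nowhere_vanishing C"
  shows "C = \<I>"
proof (rule antisym[OF subset_ideal], rule subsetI)
  fix f
  assume f: "f \<in> \<I>"
  have "(\<lambda>x. \<bar>f x\<bar>) \<in> C" "(\<lambda>x. \<bar>f x\<bar> - f x) \<in> C"
    using ideal_abs[OF ideal f] ideal_diff[OF ideal ideal_abs[OF ideal f] f]
    by (auto intro!: nonneg_mem[OF assms])
  from diff[OF this] show "f \<in> C"
    by simp
qed

end

theorem theorem4p3:
  fixes \<I> \<B> :: "('a::t2_space \<Rightarrow> real) set"
  assumes "Lindelof_space (euclidean :: 'a topology)"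
    and "locally_compact_space (euclidean :: 'a topology)"
    and "Riesz_ideal \<I>"
    and "linear_subspace_of \<B> (\<I> \<inter> bdd_cont_funs)"
    and "subalgebra_of \<B> bdd_cont_funs"
    and "strictly_point_separating \<B>"
    and "nowhere_vanishing \<B>"
  shows "ideal_closure \<I> \<B> = \<I>"
proof -
  let ?C = "ideal_closure \<I> \<B>"
  note I = assms(3)
  have B: "\<B> \<subseteq> \<I>"
    using assms(4) by (auto simp: linear_subspace_of_def)
  interpret ideal_closed_lattice \<I> ?C
  proof
    show "Riesz_ideal \<I>" "ideal_closed \<I> ?C"
      by (fact I, rule ideal_closed_ideal_closure[OF B])
    show "(\<lambda>x. f x + g x) \<in> ?C" if "f \<in> ?C" "g \<in> ?C" for f g
      by (rule ideal_closure_add[OF I B _ that])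
        (use assms(4) in \<open>auto simp: linear_subspace_of_def\<close>)
    show "(\<lambda>x. c * f x) \<in> ?C" if "f \<in> ?C" for f c
      by (rule ideal_closure_scale[OF I B _ that])
        (use assms(4) in \<open>auto simp: linear_subspace_of_def\<close>)
    show "(\<lambda>x. \<bar>f x\<bar>) \<in> ?C" if "f \<in> ?C" for f
      by (rule ideal_closure_Lipschitz_image[OF I B, where M = 1 and \<phi> = "\<lambda>f x. \<bar>f x\<bar>"])
        (use that ideal_abs[OF I] abs_generator_in_ideal_closure[OF I B assms(5)] in auto)
  qed
  have "strictly_point_separating ?C" "nowhere_vanishing ?C"
    using assms(6,7) subset_ideal_closure[of \<B> \<I>]
    unfolding strictly_point_separating_def nowhere_vanishing_def by (meson subsetD)+
  then show ?thesis
    by (rule eq_ideal[OF assms(1,2)])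
qed

end
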